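(* Let $H=(V,E)$ be a Greechie diagram (of an orthoalgebra) with $|V|\le 9$. Then $H$ admits a probability measure, i.e. there is a mapping $\mu:V\to[0,1]$ such that $\sum_{v\in e}\mu(v)=1$ for every edge $e\in E$.
   Context: A hypergraph is a pair $(V,E)$ where $V$ is a finite set of vertices and $E$ is a set of nonempty subsets of $V$ (edges) with $\bigcup_{e\in E} e = V$. A Greechie diagram is a finite hypergraph such that for all distinct edges $e,f\in E$ we have $|e\setminus f|\ge 2$ and $|e\cap f|\le 1$. Every Greechie diagram represents an orthoalgebra (OA), whose atoms are the vertices and whose maximal sets of mutually orthogonal atoms are the edges. *)

theory Defs
  imports Complex_Main "HOL-Library.FuncSet"
begin

definition hypergraph :: "'a set \<Rightarrow> 'a set set \<Rightarrow> bool" where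
  "hypergraph V E \<longleftrightarrow> finite V \<and> (\<forall>e\<in>E. e \<noteq> {}) \<and> \<Union>E = V"

definition greechie_diagram :: "'a set \<Rightarrow> 'a set set \<Rightarrow> bool" where
  "greechie_diagram V E \<longleftrightarrow>
     hypergraph V E \<and>
     (\<forall>e\<in>E. \<forall>f\<in>E. e \<noteq> f \<longrightarrow> card (e - f) \<ge> 2 \<and> card (e \<inter> f) \<le> 1)"

definition probability_measure :: "'a set \<Rightarrow> 'a set set \<Rightarrow> ('a \<Rightarrow> real) \<Rightarrow> bool" where
  "probability_measure V E \<mu> \<longleftrightarrow>
     \<mu> \<in> V \<rightarrow> {0..1} \<and> (\<forall>e\<in>E. (\<Sum>v\<in>e. \<mu> v) = 1)"

end

theory Submission
  imports Defs
begin

text \<open>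
  A single edge takes a constant weight. As soon as there are two edges, each has at least two
  vertices outside any other one; so edges of size two are disjoint from all others and can be
  weighted separately, and the problem is to weight a linear hypergraph (any two edges
  share at most one vertex) on at most nine vertices whose edges have size at least three. If all edges have size three, the constant
  \<open>1/3\<close> does it.

  Otherwise fix an edge \<open>A\<close> of size at least four. At most five vertices remain outside \<open>A\<close>. Every
  other edge \<open>f\<close> leaves a trace \<open>f - A\<close> of at least two vertices there, and the traces of
  distinct edges share at most one vertex. A trace of size two comes
  from an edge consisting of one vertex of \<open>A\<close> and that pair. Since \<open>A\<close> is given the constant weight \<open>\<alpha> = 1 / card A\<close> wherever possible, pairs must
  have weight \<open>1 - \<alpha>\<close>. Everything depends on the traces of size at least three, of which five
  vertices have room for at most two:

  \<^item> With no such trace, half of \<open>1 - \<alpha>\<close> on each outer vertex works.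
  \<^item> With one such trace \<open>T\<close>, a constant weight on \<open>T\<close> fixes the weight of the vertices outside
    \<open>A \<union> T\<close>, provided that every pair meets \<open>T\<close>
    (\<open>weighting_if_all_edges_meet_long_trace\<close>).
  \<^item> If one pair misses \<open>T\<close>, then the nine vertices are used up exactly: \<open>card A = 4\<close>,
    \<open>card T = 3\<close>, and the pair is all the rest. Here the weight on \<open>A\<close> is tilted towards the
    three vertices that do not lie on the edge of this pair
    (\<open>weighting_if_edge_misses_long_trace\<close>).
  \<^item> With two such traces, these are triples with one common vertex that exhaust the outer
    vertices (\<open>weighting_if_two_long_traces\<close>).
\<close>

section \<open>Weightings of linear hypergraphs\<close>

text \<open>Unlike a probability measure, a weighting is defined on the whole type, so it makes sense
  for a subset of the edges; the upper bound \<open>1\<close> is automatic on edges.\<close>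

definition weighting :: "'a set set \<Rightarrow> ('a \<Rightarrow> real) \<Rightarrow> bool" where
  "weighting E \<mu> \<longleftrightarrow> (\<forall>v. 0 \<le> \<mu> v) \<and> (\<forall>e\<in>E. sum \<mu> e = 1)"

lemma weightingI:
  assumes "\<And>v. 0 \<le> \<mu> v" and "\<And>e. e \<in> E \<Longrightarrow> sum \<mu> e = 1"
  shows "weighting E \<mu>"
  using assms by (simp add: weighting_def)

locale linear_hypergraph =
  fixes V :: "'a set" and E :: "'a set set"
  assumes finite_V: "finite V"
    and edge_subset: "e \<in> E \<Longrightarrow> e \<subseteq> V"
    and edge_card: "e \<in> E \<Longrightarrow> 3 \<le> card e"
    and edge_Int: "e \<in> E \<Longrightarrow> f \<in> E \<Longrightarrow> e \<noteq> f \<Longrightarrow> card (e \<inter> f) \<le> 1"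
begin

lemma finite_edge: "e \<in> E \<Longrightarrow> finite e"
  using finite_V edge_subset finite_subset by blast

lemma edge_eqI:
  assumes "e \<in> E" "f \<in> E" "x \<in> e" "y \<in> e" "x \<in> f" "y \<in> f" "x \<noteq> y"
  shows "e = f"
proof (rule ccontr)
  assume "e \<noteq> f"
  have "card {x, y} \<le> card (e \<inter> f)"
    using assms finite_edge by (intro card_mono) auto
  with edge_Int[OF assms(1,2) \<open>e \<noteq> f\<close>] \<open>x \<noteq> y\<close> show False by simp
qed

end

section \<open>The traces outside a fixed edge\<close>

locale linear_hypergraph_with_edge = linear_hypergraph +
  fixes A :: "'a set"
  assumes A_edge: "A \<in> E" and card_A: "4 \<le> card A"
begin

lemma finite_A: "finite A"
  using A_edge finite_edge by blast

text \<open>An edge with at most two vertices outside \<open>A\<close> can afford only one vertex in \<open>A\<close>, so it must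
  have exactly two outside to reach size three.\<close>

lemma short_edgeE:
  assumes "f \<in> E" "f \<noteq> A" "card (f - A) \<le> 2"
  obtains a x y where "f = {a, x, y}" "a \<in> A" "x \<notin> A" "y \<notin> A" "x \<noteq> y"
proof -
  have "card f = card (f \<inter> A) + card (f - A)"
    using finite_edge[OF assms(1)] card_Int_Diff by blast
  with edge_card[OF assms(1)] edge_Int[OF assms(1) A_edge assms(2)] assms(3)
  have c: "card (f \<inter> A) = 1" "card (f - A) = 2" by linarith+
  obtain a where a: "f \<inter> A = {a}" using c(1) card_1_singletonE by blast
  obtain x y where xy: "f - A = {x, y}" "x \<noteq> y" using c(2) card_2_iff by metis
  have "f = {a, x, y}" using a xy by blast
  with that a xy show thesis by blast
qed

lemma sum_edge_split:
  fixes \<mu> :: "'a \<Rightarrow> real"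
  assumes "f \<in> E"
  shows "sum \<mu> f = sum \<mu> (f \<inter> A) + sum \<mu> (f - A)"
  using finite_edge[OF assms] by (rule sum.Int_Diff)

lemma weighting_if_no_long_trace:
  assumes short: "\<And>f. f \<in> E \<Longrightarrow> f \<noteq> A \<Longrightarrow> card (f - A) \<le> 2"
  shows "\<exists>\<mu>. weighting E \<mu>"
proof -
  define \<alpha> where "\<alpha> = 1 / real (card A)"
  have \<alpha>: "0 \<le> \<alpha>" "\<alpha> \<le> 1" "real (card A) * \<alpha> = 1"
    using card_A by (auto simp: \<alpha>_def)
  define \<mu> where "\<mu> v = (if v \<in> A then \<alpha> else (1 - \<alpha>) / 2)" for v
  have "weighting E \<mu>"
  proof (rule weightingI)
    show "0 \<le> \<mu> v" for v using \<alpha> by (simp add: \<mu>_def)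
    fix e assume e: "e \<in> E"
    show "sum \<mu> e = 1"
    proof (cases "e = A")
      case True
      with \<alpha> show ?thesis by (simp add: \<mu>_def)
    next
      case False
      obtain a x y where "e = {a, x, y}" "a \<in> A" "x \<notin> A" "y \<notin> A" "x \<noteq> y"
        using short_edgeE[OF e False short[OF e False]] .
      then have "sum \<mu> e = \<mu> a + \<mu> x + \<mu> y"
        by (subst \<open>e = _\<close>) (auto simp: sum.insert_if)
      with \<open>a \<in> A\<close> \<open>x \<notin> A\<close> \<open>y \<notin> A\<close> show ?thesis by (simp add: \<mu>_def field_simps)
    qed
  qed
  then show ?thesis by blast
qed

text \<open>A short edge that meets the long trace \<open>T = F - A\<close> has exactly one vertex in each of \<open>A\<close>, \<open>T\<close>
  and the rest, so three constants suffice, and they are determined one after the other. The last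
  one is nonnegative because \<open>1/4 + 1/3 \<le> 1\<close>.\<close>

lemma weighting_if_all_edges_meet_long_trace:
  assumes F: "F \<in> E" "F \<noteq> A" "3 \<le> card (F - A)"
    and short: "\<And>f. f \<in> E \<Longrightarrow> f \<noteq> A \<Longrightarrow> f \<noteq> F \<Longrightarrow> card (f - A) \<le> 2"
    and meet: "\<And>f. f \<in> E \<Longrightarrow> f \<noteq> A \<Longrightarrow> f \<noteq> F \<Longrightarrow> f \<inter> (F - A) \<noteq> {}"
  shows "\<exists>\<mu>. weighting E \<mu>"
proof -
  define \<alpha> where "\<alpha> = 1 / real (card A)"
  have \<alpha>: "0 \<le> \<alpha>" "\<alpha> \<le> 1/4" "real (card A) * \<alpha> = 1"
    using card_A by (auto simp: \<alpha>_def field_simps)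
  define s where "s = 1 - real (card (F \<inter> A)) * \<alpha>"
  have "real (card (F \<inter> A)) * \<alpha> \<le> 1 * \<alpha>"
    using edge_Int[OF F(1) A_edge F(2)] \<alpha> by (intro mult_right_mono) auto
  then have s: "0 \<le> s" "s \<le> 1"
    using \<alpha> by (auto simp: s_def)
  define \<tau> where "\<tau> = s / real (card (F - A))"
  have \<tau>: "0 \<le> \<tau>" "\<tau> \<le> 1/3" "real (card (F - A)) * \<tau> = s"
    using s F(3) by (auto simp: \<tau>_def field_simps)
  define \<mu> where "\<mu> v = (if v \<in> A then \<alpha> else if v \<in> F then \<tau> else 1 - \<alpha> - \<tau>)" for v
  have "weighting E \<mu>"
  proof (rule weightingI)
    show "0 \<le> \<mu> v" for v using \<alpha> \<tau> by (simp add: \<mu>_def)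
    fix e assume e: "e \<in> E"
    consider "e = A" | "e = F" | "e \<noteq> A" "e \<noteq> F" by blast
    then show "sum \<mu> e = 1"
    proof cases
      case 1
      with \<alpha> show ?thesis by (simp add: \<mu>_def)
    next
      case 2
      have "sum \<mu> F = real (card (F \<inter> A)) * \<alpha> + real (card (F - A)) * \<tau>"
        unfolding sum_edge_split[OF F(1)] by (simp add: \<mu>_def)
      with 2 \<tau> show ?thesis by (simp add: s_def)
    next
      case 3
      obtain a x y where xy: "e = {a, x, y}" "a \<in> A" "x \<notin> A" "y \<notin> A" "x \<noteq> y"
        using short_edgeE[OF e 3(1) short[OF e 3]] .
      then have sum: "sum \<mu> e = \<mu> a + \<mu> x + \<mu> y"
        by (subst \<open>e = _\<close>) (auto simp: sum.insert_if)
      have "x \<in> F \<or> y \<in> F" using meet[OF e 3] xy by auto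
      moreover have "\<not> (x \<in> F \<and> y \<in> F)" using edge_eqI[OF e F(1), of x y] 3 xy by auto
      ultimately show ?thesis unfolding sum using xy(2-5) by (auto simp: \<mu>_def)
    qed
  qed
  then show ?thesis by blast
qed

end

section \<open>The critical configurations on nine vertices\<close>

locale linear_hypergraph_9 = linear_hypergraph_with_edge +
  assumes card_V: "card V \<le> 9"
begin

lemma card_outside: "card (V - A) \<le> 5"
proof -
  have "card (V - A) = card V - card A"
    using finite_A edge_subset[OF A_edge] by (rule card_Diff_subset)
  with card_A card_V show ?thesis by linarith
qed

text \<open>Let \<open>G\<close> consist of \<open>b \<in> A\<close> and the two vertices outside \<open>A \<union> F\<close>. No other short edge contains
  \<open>b\<close>, as it would share \<open>b\<close> and an outer vertex with \<open>G\<close>. Giving the three other vertices of \<open>A\<close>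
  weight \<open>t\<close>, the edges \<open>A\<close> and \<open>G\<close> and the short edges force the remaining weights as functions
  of \<open>t\<close>; the equation for \<open>F\<close> then determines \<open>t\<close>, depending on how \<open>F\<close> meets \<open>A\<close>.\<close>

lemma weighting_if_edge_misses_long_trace:
  assumes F: "F \<in> E" "F \<noteq> A" "3 \<le> card (F - A)"
    and short: "\<And>f. f \<in> E \<Longrightarrow> f \<noteq> A \<Longrightarrow> f \<noteq> F \<Longrightarrow> card (f - A) \<le> 2"
    and G: "G \<in> E" "G \<noteq> A" "G \<noteq> F" "G \<inter> (F - A) = {}"
  shows "\<exists>\<mu>. weighting E \<mu>"
proof -
  obtain b u w where G_eq: "G = {b, u, w}" and b: "b \<in> A" and uw: "u \<notin> A" "w \<notin> A" "u \<noteq> w"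
    using short_edgeE[OF G(1,2) short[OF G(1-3)]] .
  have uwF: "u \<notin> F" "w \<notin> F" using G(4) G_eq uw by auto
  have sub: "A \<union> (F - A) \<union> {u, w} \<subseteq> V"
    using edge_subset[OF A_edge] edge_subset[OF F(1)] edge_subset[OF G(1)] G_eq by auto
  have fin: "finite (F - A)" using finite_edge[OF F(1)] by blast
  have card_union: "card (A \<union> (F - A) \<union> {u, w}) = card A + card (F - A) + 2"
    using finite_A fin uw uwF by (subst card_Un_disjoint; (subst card_Un_disjoint)?) auto
  have card_le: "card (A \<union> (F - A) \<union> {u, w}) \<le> card V"
    using finite_V sub by (rule card_mono)
  have cA: "card A = 4" and cT: "card (F - A) = 3"
    using card_union card_le card_V card_A F(3) by linarith+
  have V_eq: "A \<union> (F - A) \<union> {u, w} = V"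
    using finite_V sub card_union card_le card_V cA cT by (intro card_subset_eq) auto

  define t :: real where
    "t = (if F \<inter> A = {} then 4/15 else if b \<in> F then 2/7 else 4/13)"
  define \<mu> where
    "\<mu> v = (if v = b then 1 - 3*t else if v \<in> A then t
            else if v \<in> F then 1 - 5/2*t else 3/2*t)" for v
  have t: "0 \<le> t" "t \<le> 1/3" by (auto simp: t_def)
  have "weighting E \<mu>"
  proof (rule weightingI)
    show "0 \<le> \<mu> v" for v using t by (simp add: \<mu>_def)
    fix e assume e: "e \<in> E"
    consider "e = A" | "e = F" | "e = G" | "e \<noteq> A" "e \<noteq> F" "e \<noteq> G" by blast
    then show "sum \<mu> e = 1"
    proof cases
      case 1
      have "sum \<mu> A = \<mu> b + sum \<mu> (A - {b})"
        using finite_A b by (rule sum.remove)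
      also have "sum \<mu> (A - {b}) = (\<Sum>v\<in>A - {b}. t)"
        by (rule sum.cong) (auto simp: \<mu>_def)
      also have "\<dots> = 3 * t"
        using finite_A b cA by simp
      finally show ?thesis using 1 by (simp add: \<mu>_def)
    next
      case 2
      have "sum \<mu> (F - A) = (\<Sum>v\<in>F - A. 1 - 5/2*t)"
        using b by (intro sum.cong) (auto simp: \<mu>_def)
      also have "\<dots> = 3 * (1 - 5/2*t)"
        by (simp add: cT)
      finally have outer: "sum \<mu> (F - A) = 3 * (1 - 5/2*t)" .
      have inner: "sum \<mu> (F \<inter> A) = 1 - 3 * (1 - 5/2*t)"
      proof (cases "F \<inter> A = {}")
        case True
        then show ?thesis by (simp add: t_def)
      next
        case False
        have "finite (F \<inter> A)" using finite_A by blast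
        with False have "card (F \<inter> A) \<noteq> 0" by simp
        with edge_Int[OF F(1) A_edge F(2)] have "card (F \<inter> A) = 1" by linarith
        then obtain a where a: "F \<inter> A = {a}" using card_1_singletonE by blast
        moreover have "b \<in> F \<longleftrightarrow> b \<in> F \<inter> A" using b by blast
        ultimately have "b \<in> F \<longleftrightarrow> a = b" by auto
        moreover have "a \<in> A" using a by blast
        ultimately show ?thesis using a by (simp add: \<mu>_def t_def)
      qed
      from outer inner 2 show ?thesis by (simp add: sum_edge_split[OF F(1)])
    next
      case 3
      have "sum \<mu> G = \<mu> b + \<mu> u + \<mu> w"
        unfolding G_eq using b uw by (auto simp: sum.insert_if)
      moreover have "u \<noteq> b" "w \<noteq> b" using b uw by auto
      ultimately show ?thesis using 3 uw uwF by (simp add: \<mu>_def)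
    next
      case 4
      obtain a x y where xy: "e = {a, x, y}" "a \<in> A" "x \<notin> A" "y \<notin> A" "x \<noteq> y"
        using short_edgeE[OF e 4(1) short[OF e 4(1,2)]] .
      then have sum: "sum \<mu> e = \<mu> a + \<mu> x + \<mu> y"
        by (subst \<open>e = _\<close>) (auto simp: sum.insert_if)
      have "x \<in> V" "y \<in> V" using edge_subset[OF e] xy by auto
      then have F_or_G: "x \<in> F \<or> x \<in> G" "y \<in> F \<or> y \<in> G" using V_eq xy G_eq by auto
      have notF: "\<not> (x \<in> F \<and> y \<in> F)" using edge_eqI[OF e F(1), of x y] 4 xy by auto
      have notG: "\<not> (x \<in> G \<and> y \<in> G)" using edge_eqI[OF e G(1), of x y] 4 xy by auto
      have one: "x \<in> F \<and> y \<notin> F \<or> x \<notin> F \<and> y \<in> F" and "x \<in> G \<or> y \<in> G"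
        using F_or_G notF notG by auto
      then have "a \<noteq> b"
        using edge_eqI[OF e G(1), of a x] edge_eqI[OF e G(1), of a y] 4 xy G_eq by auto
      moreover have "x \<noteq> b" "y \<noteq> b" using b xy by auto
      ultimately show ?thesis unfolding sum using one xy(2-5) by (auto simp: \<mu>_def)
    qed
  qed
  then show ?thesis by blast
qed

text \<open>Two long traces meet in at most one vertex and fit into five vertices, so they are triples
  with a common vertex \<open>x\<close>, and \<open>card A = 4\<close>. A third long trace has no room. A short edge avoids
  \<open>x\<close>, because the pair outside \<open>A\<close> would otherwise lie in one of the two triples; so it meets
  each triple in one further vertex. The weights \<open>p\<close> and \<open>3/4 - p\<close> of these further vertices and
  the weight \<open>q\<close> of \<open>x\<close> solve the equations \<open>q + 2 p = s\<^sub>1\<close> and \<open>q + 2 (3/4 - p) = s\<^sub>2\<close>, where \<open>s\<^sub>i\<close>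
  is what \<open>A\<close> leaves to the triple.\<close>

lemma weighting_if_two_long_traces:
  assumes F: "F \<in> E" "F \<noteq> A" "3 \<le> card (F - A)"
    and G: "G \<in> E" "G \<noteq> A" "3 \<le> card (G - A)"
    and FG: "F \<noteq> G"
  shows "\<exists>\<mu>. weighting E \<mu>"
proof -
  let ?S = "F - A" and ?T = "G - A"
  have fin: "finite ?S" "finite ?T"
    using finite_edge[OF F(1)] finite_edge[OF G(1)] by auto
  have sub: "?S \<union> ?T \<subseteq> V - A"
    using edge_subset[OF F(1)] edge_subset[OF G(1)] by auto
  have card_le: "card (?S \<union> ?T) \<le> card (V - A)"
    using finite_V sub by (intro card_mono) auto
  have "card (?S \<inter> ?T) \<le> card (F \<inter> G)"
    using finite_edge[OF F(1)] by (intro card_mono) auto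
  then have int: "card (?S \<inter> ?T) \<le> 1"
    using edge_Int[OF F(1) G(1) FG] by linarith
  have un: "card ?S + card ?T = card (?S \<union> ?T) + card (?S \<inter> ?T)"
    using fin by (rule card_Un_Int)
  have cards: "card ?S = 3" "card ?T = 3" "card (?S \<inter> ?T) = 1" "card (?S \<union> ?T) = card (V - A)"
      "card (V - A) = 5"
    using F(3) G(3) un int card_le card_outside by linarith+
  have outside: "?S \<union> ?T = V - A"
    using finite_V sub cards(4) by (intro card_subset_eq) auto
  obtain x where x: "?S \<inter> ?T = {x}" using cards(3) card_1_singletonE by blast
  have "card (V - A) = card V - card A"
    using finite_A edge_subset[OF A_edge] by (rule card_Diff_subset)
  with cards(5) card_V card_A have cA: "card A = 4" by linarith

  have short: "card (f - A) \<le> 2" if f: "f \<in> E" "f \<noteq> A" "f \<noteq> F" "f \<noteq> G" for f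
  proof -
    have "f - A \<subseteq> (f \<inter> F) \<union> (f \<inter> G)"
      using edge_subset[OF f(1)] outside by blast
    then have "card (f - A) \<le> card ((f \<inter> F) \<union> (f \<inter> G))"
      using finite_edge[OF f(1)] by (intro card_mono) auto
    also have "\<dots> \<le> card (f \<inter> F) + card (f \<inter> G)" by (rule card_Un_le)
    also have "\<dots> \<le> 2"
      using edge_Int[OF f(1) F(1) f(3)] edge_Int[OF f(1) G(1) f(4)] by linarith
    finally show ?thesis .
  qed

  define s where "s f = 1 - real (card (f \<inter> A)) / 4" for f
  have s: "3/4 \<le> s f" "s f \<le> 1" if "f \<in> E" "f \<noteq> A" for f
    using edge_Int[OF that(1) A_edge that(2)] by (auto simp: s_def)
  define p where "p = 3/8 + (s F - s G) / 4"
  define q where "q = (s F + s G) / 2 - 3/4"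
  define \<mu> where
    "\<mu> v = (if v \<in> A then 1/4 else if v = x then q else if v \<in> F then p else 3/4 - p)" for v
  have bounds: "0 \<le> p" "p \<le> 3/4" "0 \<le> q"
    using s[OF F(1,2)] s[OF G(1,2)] by (auto simp: p_def q_def diff_divide_distrib add_divide_distrib)
  have long: "sum \<mu> f = 1"
    if f: "f \<in> E" "f \<noteq> A" and c: "card (f - A) = 3" "x \<in> f - A" and q: "q + 2*r = s f"
      and r: "\<And>v. v \<in> f - A - {x} \<Longrightarrow> \<mu> v = r" for f r
  proof -
    have fin: "finite (f - A)" using finite_edge[OF f(1)] by blast
    have "sum \<mu> (f - A) = \<mu> x + sum \<mu> (f - A - {x})"
      using fin c(2) by (rule sum.remove)
    also have "sum \<mu> (f - A - {x}) = (\<Sum>v\<in>f - A - {x}. r)"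
      using r by (rule sum.cong[OF refl])
    also have "\<dots> = 2 * r" using fin c by simp
    finally have "sum \<mu> (f - A) = s f" using c(2) q by (simp add: \<mu>_def)
    moreover have "sum \<mu> (f \<inter> A) = real (card (f \<inter> A)) / 4" by (simp add: \<mu>_def)
    ultimately show ?thesis by (simp add: sum_edge_split[OF f(1)] s_def)
  qed
  have "weighting E \<mu>"
  proof (rule weightingI)
    show "0 \<le> \<mu> v" for v using bounds by (simp add: \<mu>_def)
    fix e assume e: "e \<in> E"
    consider "e = A" | "e = F" | "e = G" | "e \<noteq> A" "e \<noteq> F" "e \<noteq> G" by blast
    then show "sum \<mu> e = 1"
    proof cases
      case 1
      then show ?thesis using cA by (simp add: \<mu>_def)
    next
      case 2
      have "sum \<mu> F = 1"
      proof (rule long[OF F(1,2) cards(1)])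
        show "x \<in> F - A" using x by blast
        show "q + 2*p = s F" by (simp add: p_def q_def field_simps)
        show "\<mu> v = p" if "v \<in> F - A - {x}" for v using that by (simp add: \<mu>_def)
      qed
      with 2 show ?thesis by simp
    next
      case 3
      have "sum \<mu> G = 1"
      proof (rule long[OF G(1,2) cards(2)])
        show "x \<in> G - A" using x by blast
        show "q + 2*(3/4 - p) = s G" by (simp add: p_def q_def field_simps)
        show "\<mu> v = 3/4 - p" if "v \<in> G - A - {x}" for v
        proof -
          have "v \<notin> F" using that x by blast
          with that show ?thesis by (simp add: \<mu>_def)
        qed
      qed
      with 3 show ?thesis by simp
    next
      case 4
      obtain a y z where yz: "e = {a, y, z}" "a \<in> A" "y \<notin> A" "z \<notin> A" "y \<noteq> z"
        using short_edgeE[OF e 4(1) short[OF e 4]] .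
      then have sum: "sum \<mu> e = \<mu> a + \<mu> y + \<mu> z"
        by (subst \<open>e = _\<close>) (auto simp: sum.insert_if)
      have "y \<in> V - A" "z \<in> V - A" using edge_subset[OF e] yz by auto
      then have F_or_G: "y \<in> F \<or> y \<in> G" "z \<in> F \<or> z \<in> G" using outside by auto
      have notF: "\<not> (y \<in> F \<and> z \<in> F)" using edge_eqI[OF e F(1), of y z] 4 yz by auto
      have notG: "\<not> (y \<in> G \<and> z \<in> G)" using edge_eqI[OF e G(1), of y z] 4 yz by auto
      have one: "y \<in> F \<and> z \<notin> F \<or> y \<notin> F \<and> z \<in> F" using F_or_G notF notG by auto
      have "x \<in> F" "x \<in> G" using x by auto
      then have "y \<noteq> x" "z \<noteq> x" using F_or_G notF notG by auto
      with one yz(2-5) show ?thesis unfolding sum by (auto simp: \<mu>_def)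
    qed
  qed
  then show ?thesis by blast
qed

lemma ex_weighting: "\<exists>\<mu>. weighting E \<mu>"
proof (cases "\<exists>F\<in>E. F \<noteq> A \<and> 3 \<le> card (F - A)")
  case False
  then have "card (f - A) \<le> 2" if "f \<in> E" "f \<noteq> A" for f
    using that by fastforce
  then show ?thesis by (rule weighting_if_no_long_trace)
next
  case True
  then obtain F where F: "F \<in> E" "F \<noteq> A" "3 \<le> card (F - A)" by blast
  show ?thesis
  proof (cases "\<exists>G\<in>E. G \<noteq> A \<and> G \<noteq> F \<and> 3 \<le> card (G - A)")
    case True
    with weighting_if_two_long_traces[OF F] show ?thesis by blast
  next
    case False
    then have short: "card (f - A) \<le> 2" if "f \<in> E" "f \<noteq> A" "f \<noteq> F" for f
      using that by fastforce
    show ?thesis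
    proof (cases "\<exists>G\<in>E. G \<noteq> A \<and> G \<noteq> F \<and> G \<inter> (F - A) = {}")
      case True
      with weighting_if_edge_misses_long_trace[OF F short] show ?thesis by blast
    next
      case False
      with weighting_if_all_edges_meet_long_trace[OF F short] show ?thesis by blast
    qed
  qed
qed

end

lemma (in linear_hypergraph) ex_weighting_card_le_9:
  assumes "card V \<le> 9"
  shows "\<exists>\<mu>. weighting E \<mu>"
proof (cases "\<exists>A\<in>E. 4 \<le> card A")
  case True
  then obtain A where "A \<in> E" "4 \<le> card A" by blast
  then interpret linear_hypergraph_9 V E A
    using assms by unfold_locales
  show ?thesis by (rule ex_weighting)
next
  case False
  then have "card e = 3" if "e \<in> E" for e
    using that edge_card[OF that] by fastforce
  then have "weighting E (\<lambda>_. 1/3)" by (simp add: weighting_def)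
  then show ?thesis by blast
qed

section \<open>Greechie diagrams\<close>

lemma probability_measure_if_weighting:
  assumes "hypergraph V E" "weighting E \<mu>"
  shows "probability_measure V E \<mu>"
proof -
  have "\<mu> v \<le> 1" if "v \<in> V" for v
  proof -
    obtain e where e: "e \<in> E" "v \<in> e"
      using \<open>v \<in> V\<close> assms(1) by (auto simp: hypergraph_def)
    have "finite e"
      using assms(1) e(1) by (auto simp: hypergraph_def intro: finite_subset)
    with e have "\<mu> v \<le> sum \<mu> e"
      using assms(2) by (intro member_le_sum) (auto simp: weighting_def)
    with e assms(2) show ?thesis by (simp add: weighting_def)
  qed
  with assms(2) show ?thesis by (auto simp: probability_measure_def weighting_def)
qed

theorem theorem4:
  fixes V :: "'a set" and E :: "'a set set"
  assumes "greechie_diagram V E"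
    and "card V \<le> 9"
  shows "\<exists>\<mu>. probability_measure V E \<mu>"
proof -
  have H: "hypergraph V E"
    and diff: "\<And>e f. e \<in> E \<Longrightarrow> f \<in> E \<Longrightarrow> e \<noteq> f \<Longrightarrow> 2 \<le> card (e - f)"
    and int: "\<And>e f. e \<in> E \<Longrightarrow> f \<in> E \<Longrightarrow> e \<noteq> f \<Longrightarrow> card (e \<inter> f) \<le> 1"
    using assms(1) by (auto simp: greechie_diagram_def)
  have finV: "finite V" and sub: "\<And>e. e \<in> E \<Longrightarrow> e \<subseteq> V" and ne: "\<And>e. e \<in> E \<Longrightarrow> e \<noteq> {}"
    using H by (auto simp: hypergraph_def)
  have fin: "finite e" if "e \<in> E" for e
    using finV sub[OF that] by (rule finite_subset[rotated])
  have "\<exists>\<mu>. weighting E \<mu>"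
  proof (cases "\<exists>e. E \<subseteq> {e}")
    \<comment> \<open>Only here can an edge be a singleton.\<close>
    case True
    then obtain e where "E \<subseteq> {e}" by blast
    then have "weighting E (\<lambda>_. 1 / real (card e))"
      using ne fin by (intro weightingI) (auto simp: card_gt_0_iff)
    then show ?thesis by blast
  next
    case False
    define L where "L = {e \<in> E. 3 \<le> card e}"
    interpret linear_hypergraph V L
      using finV sub int by unfold_locales (auto simp: L_def)
    obtain \<mu> where \<mu>: "weighting L \<mu>"
      using ex_weighting_card_le_9[OF assms(2)] by blast
    define \<nu> where "\<nu> v = (if v \<in> \<Union>L then \<mu> v else 1/2)" for v
    have "weighting E \<nu>"
    proof (rule weightingI)
      show "0 \<le> \<nu> v" for v using \<mu> by (simp add: \<nu>_def weighting_def)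
      fix e assume e: "e \<in> E"
      show "sum \<nu> e = 1"
      proof (cases "e \<in> L")
        case True
        then have "sum \<nu> e = sum \<mu> e" by (intro sum.cong) (auto simp: \<nu>_def)
        with True \<mu> show ?thesis by (simp add: weighting_def)
      next
        case notL: False
        obtain f where "f \<in> E" "e \<noteq> f" using False e by blast
        then have "2 \<le> card (e - f)" using diff e by blast
        also have "\<dots> \<le> card e" using fin[OF e] by (intro card_mono) auto
        finally have c: "card e = 2" using notL e by (simp add: L_def)
        have "e \<inter> g = {}" if g: "g \<in> L" for g
        proof -
          have "2 \<le> card (e - g)"
            using diff e g notL by (auto simp: L_def)
          moreover have "card (e - g) \<le> card e"
            using fin[OF e] by (intro card_mono) auto
          ultimately have "e - g = e"
            using fin[OF e] c by (intro card_subset_eq) auto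
          then show ?thesis by blast
        qed
        then have "\<nu> v = 1/2" if "v \<in> e" for v using that by (auto simp: \<nu>_def)
        then have "sum \<nu> e = (\<Sum>v\<in>e. 1/2)" by (intro sum.cong) auto
        with c show ?thesis by simp
      qed
    qed
    then show ?thesis by blast
  qed
  with probability_measure_if_weighting[OF H] show ?thesis by blast
qed

end
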